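(* Let $(D,\le)$ be a continuous domain with a basis $B_D$. For $A\subseteq B_D$ put $\gamma(A)=\{x\in B_D:\exists a\in A,\ x\le a\}$ and $\tau(A)=\{x\in B_D:\exists a\in A,\ x\ll a\}$, write $\langle A\rangle=\tau(\gamma(A))$, and let $\mathcal{F}_D$ be the family of all finite subsets of $B_D$ that have a greatest element. Let $\mathcal{R}(B_D)$ be the set of all nonempty $U\subseteq B_D$ such that for every finite $M\subseteq U$ there is $F\in\mathcal{F}_D$ with $M\subseteq\langle F\rangle\subseteq U$. Then $(D,\le)$ is order-isomorphic to $(\mathcal{R}(B_D),\subseteq)$.
   Context: $x\ll y$ (way below) in a dcpo means: for every directed set $S$ with $y\le\bigvee S$ there is $s\in S$ with $x\le s$. A basis of a dcpo $D$ is a set $B_D\subseteq D$ such that every $x\in D$ is the supremum of a directed subset of $\{b\in B_D: b\ll x\}$; a continuous domain is a dcpo having a basis. *)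

theory Defs
  imports "HOL-Algebra.Order"
begin

(* Directed sets are nonempty, so a dcpo need not have a bottom element. *)
definition directed :: "('a, 'm) gorder_scheme \<Rightarrow> 'a set \<Rightarrow> bool" where
  "directed L S \<longleftrightarrow>
     S \<subseteq> carrier L \<and> S \<noteq> {} \<and> (\<forall>x\<in>S. \<forall>y\<in>S. \<exists>z\<in>S. x \<sqsubseteq>\<^bsub>L\<^esub> z \<and> y \<sqsubseteq>\<^bsub>L\<^esub> z)"

locale dcpo = partial_order L for L (structure) +
  assumes directed_lub_exists: "directed L S \<Longrightarrow> \<exists>s. is_lub L s S"

definition way_below :: "('a, 'm) gorder_scheme \<Rightarrow> 'a \<Rightarrow> 'a \<Rightarrow> bool" where
  "way_below L x y \<longleftrightarrow> x \<in> carrier L \<and> y \<in> carrier L \<and>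
     (\<forall>S s. directed L S \<and> is_lub L s S \<and> y \<sqsubseteq>\<^bsub>L\<^esub> s \<longrightarrow> (\<exists>d\<in>S. x \<sqsubseteq>\<^bsub>L\<^esub> d))"

definition domain_basis :: "('a, 'm) gorder_scheme \<Rightarrow> 'a set \<Rightarrow> bool" where
  "domain_basis L B \<longleftrightarrow> B \<subseteq> carrier L \<and>
     (\<forall>x\<in>carrier L. \<exists>S. S \<subseteq> {b \<in> B. way_below L b x} \<and> directed L S \<and> is_lub L x S)"

definition continuous_domain :: "('a, 'm) gorder_scheme \<Rightarrow> bool" where
  "continuous_domain L \<longleftrightarrow> dcpo L \<and> (\<exists>B. domain_basis L B)"

definition basis_gamma :: "('a, 'm) gorder_scheme \<Rightarrow> 'a set \<Rightarrow> 'a set \<Rightarrow> 'a set" where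
  "basis_gamma L B A = {x \<in> B. \<exists>a\<in>A. x \<sqsubseteq>\<^bsub>L\<^esub> a}"

definition basis_tau :: "('a, 'm) gorder_scheme \<Rightarrow> 'a set \<Rightarrow> 'a set \<Rightarrow> 'a set" where
  "basis_tau L B A = {x \<in> B. \<exists>a\<in>A. way_below L x a}"

definition basis_span :: "('a, 'm) gorder_scheme \<Rightarrow> 'a set \<Rightarrow> 'a set \<Rightarrow> 'a set" where
  "basis_span L B A = basis_tau L B (basis_gamma L B A)"

definition finite_topped :: "('a, 'm) gorder_scheme \<Rightarrow> 'a set \<Rightarrow> 'a set set" where
  "finite_topped L B = {F. F \<subseteq> B \<and> finite F \<and> (\<exists>g. greatest L g F)}"

definition basis_R :: "('a, 'm) gorder_scheme \<Rightarrow> 'a set \<Rightarrow> 'a set set" where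
  "basis_R L B = {U. U \<subseteq> B \<and> U \<noteq> {} \<and>
     (\<forall>M. finite M \<and> M \<subseteq> U \<longrightarrow>
        (\<exists>F\<in>finite_topped L B. M \<subseteq> basis_span L B F \<and> basis_span L B F \<subseteq> U))}"

definition inclusion_order :: "'a set set \<Rightarrow> 'a set gorder" where
  "inclusion_order \<A> = \<lparr>carrier = \<A>, eq = (=), le = (\<subseteq>)\<rparr>"

definition order_isomorphic :: "('a, 'm) gorder_scheme \<Rightarrow> ('b, 'n) gorder_scheme \<Rightarrow> bool" where
  "order_isomorphic L K \<longleftrightarrow> (\<exists>f. bij_betw f (carrier L) (carrier K) \<and> order_emb L K f)"

end

theory Submission
  imports Defs
begin

text \<open>If \<open>F\<close> has greatest element \<open>g\<close>, then \<open>\<langle>F\<rangle>\<close> is just the set of basis elements way below \<open>g\<close>.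
  Sending \<open>x\<close> to the set of basis elements way below \<open>x\<close> is an order embedding because \<open>x\<close> is the
  supremum of this set, and it lands in \<open>\<R>(B)\<close> by interpolation. Conversely, every \<open>U \<in> \<R>(B)\<close> is
  directed and arises from its own supremum.\<close>

lemma directed_upper_bound:
  assumes "directed L S" "x \<in> S" "y \<in> S"
  obtains z where "z \<in> S" "x \<sqsubseteq>\<^bsub>L\<^esub> z" "y \<sqsubseteq>\<^bsub>L\<^esub> z"
  using assms unfolding directed_def by blast

locale based_dcpo = dcpo L for L (structure) +
  fixes B :: "'a set"
  assumes basis: "domain_basis L B"
begin

text \<open>This is \<open>basis_tau L B {x}\<close>; as a function of \<open>x\<close> it is the
  isomorphism to be constructed.\<close>

definition basis_below :: "'a \<Rightarrow> 'a set" where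
  "basis_below x = {b \<in> B. way_below L b x}"

lemma basis_carrier: "B \<subseteq> carrier L"
  using basis by (simp add: domain_basis_def)

lemma basis_below_subset: "basis_below x \<subseteq> B"
  by (auto simp: basis_below_def)

lemma basis_below_carrier: "basis_below x \<subseteq> carrier L"
  using basis_below_subset basis_carrier by blast

section \<open>The way-below relation and its interaction with the order\<close>

lemma way_below_closed:
  assumes "way_below L x y"
  shows "x \<in> carrier L" "y \<in> carrier L"
  using assms by (simp_all add: way_below_def)

lemma way_below_dest:
  assumes "way_below L x y" "directed L S" "is_lub L s S" "y \<sqsubseteq> s"
  shows "\<exists>d\<in>S. x \<sqsubseteq> d"
  using assms unfolding way_below_def by blast

lemma way_below_mono_right:
  assumes "way_below L x y" "y \<sqsubseteq> z" "z \<in> carrier L"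
  shows "way_below L x z"
  unfolding way_below_def
proof (intro conjI allI impI)
  show "x \<in> carrier L" "z \<in> carrier L"
    using assms way_below_closed by auto
  fix S s assume S: "directed L S \<and> is_lub L s S \<and> z \<sqsubseteq> s"
  then have "y \<sqsubseteq> s"
    using assms way_below_closed le_trans[of y z s] by auto
  with S show "\<exists>d\<in>S. x \<sqsubseteq> d"
    using assms(1) way_below_dest by blast
qed

text \<open>Membership of \<open>x\<close> in the carrier is assumed because
  \<open>x \<sqsubseteq> y\<close> alone does not imply it.\<close>

lemma way_below_mono_left:
  assumes "x \<sqsubseteq> y" "way_below L y z" "x \<in> carrier L"
  shows "way_below L x z"
  unfolding way_below_def
proof (intro conjI allI impI)
  show "x \<in> carrier L" "z \<in> carrier L"
    using assms way_below_closed by auto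
  fix S s assume S: "directed L S \<and> is_lub L s S \<and> z \<sqsubseteq> s"
  then obtain d where d: "d \<in> S" "y \<sqsubseteq> d"
    using assms(2) way_below_dest by blast
  have "d \<in> carrier L"
    using S d(1) by (auto simp: directed_def)
  with d assms show "\<exists>d\<in>S. x \<sqsubseteq> d"
    using le_trans[of x y d] way_below_closed by blast
qed

lemma directed_singleton: "x \<in> carrier L \<Longrightarrow> directed L {x}"
  by (simp add: directed_def)

lemma is_lub_singleton: "x \<in> carrier L \<Longrightarrow> is_lub L x {x}"
  by (rule least_UpperI) auto

text \<open>Test the definition on the directed set \<open>{y}\<close>, whose supremum is
  \<open>y\<close>.\<close>

lemma way_below_imp_le: "way_below L x y \<Longrightarrow> x \<sqsubseteq> y"
  using way_below_dest[of x y "{y}" y] way_below_closed[of x y]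
    directed_singleton is_lub_singleton by auto

section \<open>Approximation of points by the basis\<close>

lemma basis_below_mono:
  assumes "x \<sqsubseteq> y" "y \<in> carrier L"
  shows "basis_below x \<subseteq> basis_below y"
  using assms way_below_mono_right by (auto simp: basis_below_def)

lemma obtain_approximating_set:
  assumes "x \<in> carrier L"
  obtains S where "S \<subseteq> basis_below x" "directed L S" "is_lub L x S"
  using assms basis unfolding domain_basis_def basis_below_def by blast

text \<open>The basis axiom only provides some directed \<open>S\<close> inside
  \<open>basis_below x\<close>. This \<open>S\<close> is cofinal: anything way below
  \<open>x\<close>, the supremum of \<open>S\<close>, lies under a member of
  \<open>S\<close>.\<close>

lemma directed_basis_below:
  assumes "x \<in> carrier L"
  shows "directed L (basis_below x)"
proof -
  obtain S where S: "S \<subseteq> basis_below x" "directed L S" "is_lub L x S"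
    using assms by (rule obtain_approximating_set)
  show ?thesis
    unfolding directed_def
  proof (intro conjI ballI)
    show "basis_below x \<subseteq> carrier L" by (rule basis_below_carrier)
    show "basis_below x \<noteq> {}" using S by (auto simp: directed_def)
    fix a b assume ab: "a \<in> basis_below x" "b \<in> basis_below x"
    then have "way_below L a x" "way_below L b x" by (auto simp: basis_below_def)
    then obtain s t where st: "s \<in> S" "a \<sqsubseteq> s" "t \<in> S" "b \<sqsubseteq> t"
      using way_below_dest[OF _ S(2,3)] assms by (meson le_refl)
    then obtain r where r: "r \<in> S" "s \<sqsubseteq> r" "t \<sqsubseteq> r"
      using directed_upper_bound[OF S(2)] by metis
    have "a \<in> carrier L" "b \<in> carrier L" "s \<in> carrier L" "t \<in> carrier L" "r \<in> carrier L"
      using ab st r S basis_below_carrier by blast+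
    then have "a \<sqsubseteq> r" "b \<sqsubseteq> r"
      using st r le_trans[of a s r] le_trans[of b t r] by auto
    with r S show "\<exists>z\<in>basis_below x. a \<sqsubseteq> z \<and> b \<sqsubseteq> z" by blast
  qed
qed

text \<open>Such a \<open>u\<close> bounds the approximating set, whose supremum is
  \<open>x\<close>. Together with \<open>way_below_imp_le\<close> this makes \<open>x\<close> the
  supremum of all of \<open>basis_below x\<close>.\<close>

lemma le_if_basis_below_le:
  assumes "x \<in> carrier L" "u \<in> carrier L" "\<And>b. b \<in> basis_below x \<Longrightarrow> b \<sqsubseteq> u"
  shows "x \<sqsubseteq> u"
proof -
  obtain S where S: "S \<subseteq> basis_below x" "is_lub L x S"
    using assms(1) by (rule obtain_approximating_set)
  have "u \<in> Upper L S"
    using S assms by (intro Upper_memI) auto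
  with S(2) show ?thesis by (rule least_le)
qed

lemma basis_below_subset_iff:
  assumes "x \<in> carrier L" "y \<in> carrier L"
  shows "basis_below x \<subseteq> basis_below y \<longleftrightarrow> x \<sqsubseteq> y"
proof
  assume sub: "basis_below x \<subseteq> basis_below y"
  show "x \<sqsubseteq> y"
  proof (rule le_if_basis_below_le[OF assms])
    fix b assume "b \<in> basis_below x"
    with sub have "b \<in> basis_below y" by (rule subsetD)
    then show "b \<sqsubseteq> y" using way_below_imp_le by (simp add: basis_below_def)
  qed
qed (rule basis_below_mono[OF _ assms(2)])

lemma inj_on_basis_below: "inj_on basis_below (carrier L)"
proof (rule inj_onI)
  fix x y assume "x \<in> carrier L" "y \<in> carrier L" "basis_below x = basis_below y"
  then show "x = y"
    using basis_below_subset_iff[of x y] basis_below_subset_iff[of y x] by (intro le_antisym) auto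
qed

text \<open>The elements approximated in two steps form a directed set with supremum \<open>x\<close>, so anything
  way below \<open>x\<close> lies below one of them.\<close>

lemma interpolation:
  assumes "way_below L a x"
  obtains b where "b \<in> basis_below x" "way_below L a b"
proof -
  have x: "x \<in> carrier L" and a: "a \<in> carrier L"
    using assms way_below_closed by auto
  define T where "T = (\<Union>b\<in>basis_below x. basis_below b)"
  have T_carrier: "T \<subseteq> carrier L"
    using basis_below_carrier by (auto simp: T_def)
  have "directed L T"
    unfolding directed_def
  proof (intro conjI ballI)
    show "T \<subseteq> carrier L" by fact
    obtain b where b: "b \<in> basis_below x"
      using directed_basis_below[OF x] by (auto simp: directed_def)
    then have "basis_below b \<noteq> {}"
      using directed_basis_below[of b] basis_below_carrier by (auto simp: directed_def)
    with b show "T \<noteq> {}" by (auto simp: T_def)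
    fix c d assume "c \<in> T" "d \<in> T"
    then obtain p q where pq: "p \<in> basis_below x" "c \<in> basis_below p"
        "q \<in> basis_below x" "d \<in> basis_below q"
      by (auto simp: T_def)
    \<comment> \<open>Raising \<open>p\<close> and \<open>q\<close> to a common \<open>r\<close>
      puts \<open>c\<close> and \<open>d\<close> into one set \<open>basis_below r\<close>, which is
      already known to be directed.\<close>
    then obtain r where r: "r \<in> basis_below x" "p \<sqsubseteq> r" "q \<sqsubseteq> r"
      using directed_upper_bound[OF directed_basis_below[OF x]] by metis
    then have rc: "r \<in> carrier L" using basis_below_carrier by blast
    have "c \<in> basis_below r" "d \<in> basis_below r"
      using pq r basis_below_mono[OF _ rc] by blast+
    then obtain z where "z \<in> basis_below r" "c \<sqsubseteq> z" "d \<sqsubseteq> z"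
      using directed_upper_bound[OF directed_basis_below[OF rc]] by metis
    with r show "\<exists>z\<in>T. c \<sqsubseteq> z \<and> d \<sqsubseteq> z" by (auto simp: T_def)
  qed
  moreover have "is_lub L x T"
  proof (rule least_UpperI)
    fix t assume "t \<in> T"
    then obtain b where b: "b \<in> basis_below x" "t \<in> basis_below b"
      by (auto simp: T_def)
    then have "t \<in> basis_below x"
      using basis_below_mono[of b x] x way_below_imp_le by (auto simp: basis_below_def)
    then show "t \<sqsubseteq> x"
      using way_below_imp_le by (auto simp: basis_below_def)
  next
    fix u assume u: "u \<in> Upper L T"
    then have uc: "u \<in> carrier L" by (rule subsetD[OF Upper_closed])
    \<comment> \<open>The two steps of approximation are undone one at a time: \<open>u\<close>
      bounds each \<open>basis_below b\<close>, hence each \<open>b\<close>, hence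
      \<open>x\<close>.\<close>
    show "x \<sqsubseteq> u"
    proof (rule le_if_basis_below_le[OF x uc])
      fix b assume b: "b \<in> basis_below x"
      then have bc: "b \<in> carrier L" using basis_below_carrier by blast
      show "b \<sqsubseteq> u"
      proof (rule le_if_basis_below_le[OF bc uc])
        fix c assume "c \<in> basis_below b"
        with b have "c \<in> T" by (auto simp: T_def)
        then show "c \<sqsubseteq> u" using Upper_memD[OF u _ T_carrier] by blast
      qed
    qed
  qed (use T_carrier x in auto)
  ultimately obtain t where "t \<in> T" "a \<sqsubseteq> t"
    using assms way_below_dest x le_refl by blast
  then obtain b where "b \<in> basis_below x" "way_below L t b" "a \<sqsubseteq> t"
    by (auto simp: T_def basis_below_def)
  then show ?thesis using that way_below_mono_left a by blast
qed

text \<open>Interpolate below \<open>x\<close> for each new element and merge the result with the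
  previous witness by directedness. This supplies the witnesses demanded by
  \<open>basis_R\<close>.\<close>

lemma finite_interpolation:
  assumes "x \<in> carrier L" "finite M" "M \<subseteq> basis_below x"
  shows "\<exists>g\<in>basis_below x. M \<subseteq> basis_below g"
  using assms(2,3)
proof (induction M rule: finite_induct)
  case empty
  then show ?case using directed_basis_below[OF assms(1)] by (auto simp: directed_def)
next
  case (insert m M)
  then obtain g where g: "g \<in> basis_below x" "M \<subseteq> basis_below g" by auto
  obtain h where h: "h \<in> basis_below x" "way_below L m h"
    using insert.prems interpolation[of m x] by (auto simp: basis_below_def)
  then have mh: "m \<in> basis_below h"
    using insert.prems by (auto simp: basis_below_def)
  obtain k where k: "k \<in> basis_below x" "g \<sqsubseteq> k" "h \<sqsubseteq> k"
    using directed_upper_bound[OF directed_basis_below[OF assms(1)] g(1) h(1)] .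
  then have "k \<in> carrier L" using basis_below_carrier by blast
  then have "insert m M \<subseteq> basis_below k"
    using g mh k basis_below_mono by blast
  with k show ?case by blast
qed

section \<open>Describing \<open>basis_R\<close> by single basis elements\<close>

lemma basis_span_greatest:
  assumes "F \<subseteq> B" "greatest L g F"
  shows "basis_span L B F = basis_below g"
proof -
  have g: "g \<in> F" "g \<in> carrier L"
    using greatest_mem[OF assms(2)] greatest_closed[OF assms(2)] by auto
  have "way_below L x g" if "way_below L x c" "c \<sqsubseteq> a" "a \<in> F" for x c a
  proof -
    have "a \<sqsubseteq> g" "a \<in> carrier L"
      using that assms basis_carrier by (auto simp: greatest_def)
    then have "c \<sqsubseteq> g" using that g way_below_closed le_trans[of c a g] by blast
    then show ?thesis using that g way_below_mono_right by blast
  qed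
  \<comment> \<open>Both \<open>c\<close> and \<open>a\<close> can be taken to be \<open>g\<close>,
    which lies in \<open>F\<close> and hence in \<open>B\<close>.\<close>
  moreover have "\<exists>c\<in>B. (\<exists>a\<in>F. c \<sqsubseteq> a) \<and> way_below L x c" if "way_below L x g" for x
    using that g assms(1) le_refl by blast
  ultimately show ?thesis
    unfolding basis_span_def basis_tau_def basis_gamma_def basis_below_def by blast
qed

text \<open>The span of a topped set depends only on its greatest element, so \<open>F\<close> can
  be traded for that element, and conversely \<open>g\<close> for the singleton
  \<open>{g}\<close>.\<close>

lemma basis_R_iff:
  "U \<in> basis_R L B \<longleftrightarrow> U \<subseteq> B \<and> U \<noteq> {} \<and>
     (\<forall>M. finite M \<and> M \<subseteq> U \<longrightarrow> (\<exists>g\<in>B. M \<subseteq> basis_below g \<and> basis_below g \<subseteq> U))"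
proof -
  have "(\<exists>F\<in>finite_topped L B. M \<subseteq> basis_span L B F \<and> basis_span L B F \<subseteq> U) \<longleftrightarrow>
      (\<exists>g\<in>B. M \<subseteq> basis_below g \<and> basis_below g \<subseteq> U)" (is "?l \<longleftrightarrow> ?r") for M
  proof
    assume ?l
    then obtain F g where "F \<subseteq> B" "greatest L g F"
        "M \<subseteq> basis_span L B F" "basis_span L B F \<subseteq> U"
      by (auto simp: finite_topped_def)
    then show ?r using basis_span_greatest greatest_mem[of L g F] by blast
  next
    assume ?r
    then obtain g where g: "g \<in> B" "M \<subseteq> basis_below g" "basis_below g \<subseteq> U" by blast
    then have "greatest L g {g}" using basis_carrier by (auto simp: greatest_def)
    moreover from this g have "{g} \<in> finite_topped L B" by (auto simp: finite_topped_def)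
    ultimately show ?l using g basis_span_greatest[of "{g}" g] by auto
  qed
  then show ?thesis by (simp add: basis_R_def)
qed

lemma basis_R_witness:
  assumes "U \<in> basis_R L B" "finite M" "M \<subseteq> U"
  obtains g where "g \<in> B" "M \<subseteq> basis_below g" "basis_below g \<subseteq> U"
  using assms basis_R_iff[of U] by metis

text \<open>The interpolant \<open>g\<close> is itself way below \<open>x\<close>, so
  \<open>basis_below g\<close> stays inside \<open>basis_below x\<close>.\<close>

lemma basis_below_in_basis_R:
  assumes x: "x \<in> carrier L"
  shows "basis_below x \<in> basis_R L B"
  unfolding basis_R_iff
proof (intro conjI allI impI)
  show "basis_below x \<noteq> {}" using directed_basis_below[OF x] by (simp add: directed_def)
  fix M assume "finite M \<and> M \<subseteq> basis_below x"
  then obtain g where g: "g \<in> basis_below x" "M \<subseteq> basis_below g"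
    using finite_interpolation[OF x] by blast
  moreover from g have "basis_below g \<subseteq> basis_below x"
    using x by (intro basis_below_mono way_below_imp_le) (auto simp: basis_below_def)
  ultimately show "\<exists>g\<in>B. M \<subseteq> basis_below g \<and> basis_below g \<subseteq> basis_below x"
    using basis_below_subset by blast
qed (rule basis_below_subset)

text \<open>The witness \<open>g\<close> for \<open>{a, b} \<subseteq> U\<close> need not belong to \<open>U\<close>, so the common upper bound is taken
  in \<open>basis_below g\<close>.\<close>

lemma directed_basis_R:
  assumes "U \<in> basis_R L B"
  shows "directed L U"
  unfolding directed_def
proof (intro conjI ballI)
  show "U \<subseteq> carrier L" "U \<noteq> {}" using assms basis_carrier by (auto simp: basis_R_iff)
  fix a b assume "a \<in> U" "b \<in> U"
  then obtain g where g: "g \<in> B" "{a, b} \<subseteq> basis_below g" "basis_below g \<subseteq> U"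
    using basis_R_witness[OF assms, of "{a, b}"] by auto
  have "directed L (basis_below g)"
    using directed_basis_below[OF subsetD[OF basis_carrier g(1)]] .
  moreover have "a \<in> basis_below g" "b \<in> basis_below g"
    using g by auto
  ultimately obtain z where "z \<in> basis_below g" "a \<sqsubseteq> z" "b \<sqsubseteq> z"
    by (rule directed_upper_bound)
  with g show "\<exists>z\<in>U. a \<sqsubseteq> z \<and> b \<sqsubseteq> z" by blast
qed

text \<open>Both inclusions apply the defining condition to a singleton \<open>{u}\<close>: some
  \<open>g\<close> has \<open>u\<close> way below it and \<open>basis_below g\<close> inside
  \<open>U\<close>.\<close>

lemma basis_R_eq_basis_below_lub:
  assumes U: "U \<in> basis_R L B" and lub: "is_lub L x U"
  shows "U = basis_below x"
proof -
  have x: "x \<in> carrier L" by (rule least_closed[OF lub])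
  have UL: "U \<subseteq> carrier L"
    using U basis_carrier by (auto simp: basis_R_iff)
  have witness: "\<exists>g\<in>B. u \<in> basis_below g \<and> basis_below g \<subseteq> U" if "u \<in> U" for u
    using basis_R_witness[OF U, of "{u}"] that by auto
  show ?thesis
  proof
    show "U \<subseteq> basis_below x"
    proof
      fix u assume "u \<in> U"
      then obtain g where g: "g \<in> B" "u \<in> basis_below g" "basis_below g \<subseteq> U"
        using witness by blast
      \<comment> \<open>As \<open>g\<close> may lie outside \<open>U\<close>, it is compared with
        \<open>x\<close> through its approximants, which do lie in \<open>U\<close>.\<close>
      have "g \<sqsubseteq> x"
      proof (rule le_if_basis_below_le)
        show "g \<in> carrier L" "x \<in> carrier L" using g basis_carrier x by auto
        show "b \<sqsubseteq> x" if "b \<in> basis_below g" for b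
          using least_Upper_above[OF lub _ UL] that g by blast
      qed
      then show "u \<in> basis_below x" using basis_below_mono x g by blast
    qed
    show "basis_below x \<subseteq> U"
    proof
      fix b assume b: "b \<in> basis_below x"
      then have "way_below L b x" by (simp add: basis_below_def)
      then obtain u where u: "u \<in> U" "b \<sqsubseteq> u"
        using way_below_dest[OF _ directed_basis_R[OF U] lub le_refl[OF x]] by blast
      then obtain g where "g \<in> B" "u \<in> basis_below g" "basis_below g \<subseteq> U"
        using witness by blast
      \<comment> \<open>From \<open>b \<sqsubseteq> u\<close> and \<open>u\<close> way below
        \<open>g\<close> it follows that \<open>b\<close> is way below \<open>g\<close>; thus
        \<open>U\<close> is a lower set within \<open>B\<close>.\<close>
      moreover from this u b have "b \<in> basis_below g"
        using way_below_mono_left basis_carrier by (auto simp: basis_below_def)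
      ultimately show "b \<in> U" by blast
    qed
  qed
qed

section \<open>The order isomorphism\<close>

lemma bij_betw_basis_below: "bij_betw basis_below (carrier L) (basis_R L B)"
  unfolding bij_betw_def
proof (intro conjI equalityI subsetI)
  show "inj_on basis_below (carrier L)" by (rule inj_on_basis_below)
  show "U \<in> basis_R L B" if "U \<in> basis_below ` carrier L" for U
    using that basis_below_in_basis_R by blast
  fix U assume U: "U \<in> basis_R L B"
  \<comment> \<open>Directed completeness enters here: it provides the supremum of \<open>U\<close>,
    which is the preimage sought.\<close>
  then obtain x where lub: "is_lub L x U"
    using directed_lub_exists[OF directed_basis_R[OF U]] by blast
  show "U \<in> basis_below ` carrier L"
    using basis_R_eq_basis_below_lub[OF U lub] least_closed[OF lub] by (rule image_eqI)
qed

end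

lemma weak_partial_order_inclusion_order: "weak_partial_order (inclusion_order \<A>)"
  unfolding inclusion_order_def by unfold_locales auto

theorem theorem3p18:
  fixes D :: "('a, 'm) gorder_scheme" and B :: "'a set"
  assumes "continuous_domain D" and "domain_basis D B"
  shows "order_isomorphic D (inclusion_order (basis_R D B))"
proof -
  interpret based_dcpo D B
    using assms by (simp add: based_dcpo_def based_dcpo_axioms_def continuous_domain_def)
  have "order_emb D (inclusion_order (basis_R D B)) basis_below"
    using weak_partial_order_axioms weak_partial_order_inclusion_order basis_below_subset_iff
    by (simp add: order_emb_def inclusion_order_def)
  moreover have "bij_betw basis_below (carrier D) (carrier (inclusion_order (basis_R D B)))"
    using bij_betw_basis_below by (simp add: inclusion_order_def)
  ultimately show ?thesis unfolding order_isomorphic_def by blast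
qed

end
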